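(* Let $R$ be a $*$-ring and let $a\in R$. Then the following are equivalent: (1) $a\in R^{\mathcal H}$; (2) $a\in R^{\dagger}$ and $a^{\dagger}a^3a^{\dagger}\in R^{\dagger}$. In this case, $a^{\mathcal H}=[a^{\dagger}a^3a^{\dagger}]^{\dagger}$.
   Context: A $*$-ring is an associative ring $R$ with identity and with an involution $x\mapsto x^*$ satisfying $(x+y)^*=x^*+y^*$, $(xy)^*=y^*x^*$, $(x^* )^*=x$ for all $x,y\in R$ (and $(\lambda x)^*=\overline{\lambda}x^*$ for $\lambda\in\mathbb C$ when $R$ carries a complex scalar multiplication). An element $a\in R$ is Moore-Penrose invertible if there is $x\in R$ with $xax=x$, $axa=a$, $(ax)^*=ax$, $(xa)^*=xa$; such $x$ is unique and denoted $a^{\dagger}$. $R^{\dagger}$ is the set of Moore-Penrose invertible elements. An element $a\in R^{\dagger}$ has an $\mathcal H$-group inverse (higher-order group inverse) if there exists $x\in aR\cap Ra$ such that $xax=x$, $a^2xa^2=a^3$, $(a^2xa^* )^*=a^2xa^*$, $(a^*xa^2)^*=a^*xa^2$. If such $x$ exists it is unique and is denoted $a^{\mathcal H}$. $R^{\mathcal H}$ is the set of elements (of $R^\dagger$) having an $\mathcal H$-group inverse. *)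

theory Defs
  imports Main
begin

(* Not based on ring_1, whose axiom 0 ~= 1 would exclude the zero ring. *)
class star_ring = ring + monoid_mult +
  fixes star :: "'a \<Rightarrow> 'a"  ("_\<^sup>\<star>" [1000] 999)
  assumes star_add: "(x + y)\<^sup>\<star> = x\<^sup>\<star> + y\<^sup>\<star>"
    and star_mult: "(x * y)\<^sup>\<star> = y\<^sup>\<star> * x\<^sup>\<star>"
    and star_star: "(x\<^sup>\<star>)\<^sup>\<star> = x"

definition is_mp_inverse :: "'a::star_ring \<Rightarrow> 'a \<Rightarrow> bool" where
  "is_mp_inverse a x \<longleftrightarrow>
     x * a * x = x \<and> a * x * a = a \<and> (a * x)\<^sup>\<star> = a * x \<and> (x * a)\<^sup>\<star> = x * a"

definition mp_invertibles :: "'a::star_ring set"  ("R\<^sup>\<dagger>") where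
  "R\<^sup>\<dagger> = {a. \<exists>x. is_mp_inverse a x}"

(* Unspecified for elements that are not Moore-Penrose invertible. *)
definition mp_inverse :: "'a::star_ring \<Rightarrow> 'a"  ("_\<^sup>\<dagger>" [1000] 999) where
  "a\<^sup>\<dagger> = (THE x. is_mp_inverse a x)"

definition is_hgroup_inverse :: "'a::star_ring \<Rightarrow> 'a \<Rightarrow> bool" where
  "is_hgroup_inverse a x \<longleftrightarrow>
     x \<in> range (\<lambda>r. a * r) \<inter> range (\<lambda>r. r * a) \<and>
     x * a * x = x \<and>
     a ^ 2 * x * a ^ 2 = a ^ 3 \<and>
     (a ^ 2 * x * a\<^sup>\<star>)\<^sup>\<star> = a ^ 2 * x * a\<^sup>\<star> \<and>
     (a\<^sup>\<star> * x * a ^ 2)\<^sup>\<star> = a\<^sup>\<star> * x * a ^ 2"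

definition hgroup_invertibles :: "'a::star_ring set"  ("R\<^sup>\<H>") where
  "R\<^sup>\<H> = {a \<in> R\<^sup>\<dagger>. \<exists>x. is_hgroup_inverse a x}"

(* Unspecified for elements outside the set of H-group invertible elements. *)
definition hgroup_inverse :: "'a::star_ring \<Rightarrow> 'a"  ("_\<^sup>\<H>" [1000] 999) where
  "a\<^sup>\<H> = (THE x. is_hgroup_inverse a x)"

lemma is_mp_inverse_unique:
  fixes a :: "'a::star_ring"
  assumes x: "is_mp_inverse a x" and y: "is_mp_inverse a y"
  shows "x = y"
proof -
  have ax: "a * x = a * y"
  proof -
    have "a * x = (a * x)\<^sup>\<star>" using x by (simp add: is_mp_inverse_def)
    also have "\<dots> = (a * y * (a * x))\<^sup>\<star>"
      using y by (simp add: is_mp_inverse_def mult.assoc[symmetric])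
    also have "\<dots> = a * x * (a * y)"
      using x y star_mult[of "a * y" "a * x"] by (simp add: is_mp_inverse_def)
    also have "\<dots> = a * y"
      using x by (simp add: is_mp_inverse_def mult.assoc[symmetric])
    finally show ?thesis .
  qed
  have xa: "x * a = y * a"
  proof -
    have "x * a = (x * a)\<^sup>\<star>" using x by (simp add: is_mp_inverse_def)
    also have "\<dots> = (x * a * (y * a))\<^sup>\<star>"
      using y by (simp add: is_mp_inverse_def mult.assoc)
    also have "\<dots> = y * a * (x * a)"
      using x y star_mult[of "x * a" "y * a"] by (simp add: is_mp_inverse_def)
    also have "\<dots> = y * a"
      using x by (simp add: is_mp_inverse_def mult.assoc)
    finally show ?thesis .
  qed
  have "x = x * a * x" using x by (simp add: is_mp_inverse_def)
  also have "\<dots> = y * a * y" using ax xa by (metis mult.assoc)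
  also have "\<dots> = y" using y by (simp add: is_mp_inverse_def)
  finally show ?thesis .
qed

lemma is_mp_inverse_mp_inverse:
  fixes a :: "'a::star_ring"
  assumes "a \<in> R\<^sup>\<dagger>"
  shows "is_mp_inverse a (a\<^sup>\<dagger>)"
  unfolding mp_inverse_def
  using assms is_mp_inverse_unique by (auto simp: mp_invertibles_def intro: theI)

end

theory Submission
  imports Defs
begin

text \<open>
  Let \<open>b\<close> be the Moore-Penrose inverse of \<open>a\<close>.  Then \<open>q = a * b\<close> and \<open>p = b * a\<close> are self-adjoint
  idempotents with \<open>q * a = a = a * p\<close>, and the element in the theorem is the compression
  \<open>w = b * a ^ 3 * b = p * a * q\<close>.  The range condition on an \<open>\<H>\<close>-group inverse \<open>x\<close>, namely
  \<open>x \<in> aR \<inter> Ra\<close>, says precisely \<open>q * x = x = x * p\<close>.  For such \<open>x\<close> the element \<open>a\<close> cannot be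
  told apart from \<open>w\<close>: \<open>p * a * x = w * x\<close>, \<open>x * a * q = x * w\<close> and
  \<open>x * a * x = x * w * x\<close>.  Hence the defining
  equations of an \<open>\<H>\<close>-group inverse of \<open>a\<close> become those of a Moore-Penrose inverse of \<open>w\<close> after
  multiplication by \<open>b\<close> or its adjoint on the outside, and multiplying by \<open>a\<close> or its adjoint
  reverses this.  A Moore-Penrose inverse of \<open>w\<close> automatically lies in \<open>aR \<inter> Ra\<close>, since it has the
  same left and right range as the adjoint of \<open>w\<close>, which is \<open>q * a\<^sup>\<star> * p\<close>.  So the two
  kinds of inverse are the same elements (lemma \<open>is_hgroup_inverse_iff_is_mp_inverse\<close>), and both
  the equivalence and the formula follow.
\<close>

lemma star_congruence:
  fixes c h :: "'a::star_ring"
  assumes "h\<^sup>\<star> = h"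
  shows "(c * h * c\<^sup>\<star>)\<^sup>\<star> = c * h * c\<^sup>\<star>" and "(c\<^sup>\<star> * h * c)\<^sup>\<star> = c\<^sup>\<star> * h * c"
  using assms by (simp_all add: star_mult star_star mult.assoc)

lemma range_mult_left_iff:
  fixes a b x :: "'a::star_ring"
  assumes "a * b * a = a"
  shows "x \<in> range (\<lambda>r. a * r) \<longleftrightarrow> a * b * x = x"
proof
  assume "x \<in> range (\<lambda>r. a * r)"
  then show "a * b * x = x" using assms by (metis imageE mult.assoc)
next
  assume "a * b * x = x"
  then show "x \<in> range (\<lambda>r. a * r)" by (metis mult.assoc rangeI)
qed

lemma range_mult_right_iff:
  fixes a b x :: "'a::star_ring"
  assumes "a * b * a = a"
  shows "x \<in> range (\<lambda>r. r * a) \<longleftrightarrow> x * (b * a) = x"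
proof
  assume "x \<in> range (\<lambda>r. r * a)"
  then show "x * (b * a) = x" using assms by (auto simp: mult.assoc)
next
  assume "x * (b * a) = x"
  then show "x \<in> range (\<lambda>r. r * a)" by (metis mult.assoc rangeI)
qed

text \<open>
  A Moore-Penrose inverse factors through the adjoint on either side:
  \<open>x = (x * w) * x = w\<^sup>\<star> * x\<^sup>\<star> * x\<close>, and dually.  So it inherits every self-adjoint left unit
  of \<open>w\<close> as a right unit, and vice versa.
\<close>

lemma is_mp_inverse_inherits_units:
  fixes w x p q :: "'a::star_ring"
  assumes mp: "is_mp_inverse w x"
    and p: "p\<^sup>\<star> = p" "p * w = w" and q: "q\<^sup>\<star> = q" "w * q = w"
  shows "q * x = x" and "x * p = x"
proof -
  have xwx: "x * w * x = x" and wx: "(w * x)\<^sup>\<star> = w * x" and xw: "(x * w)\<^sup>\<star> = x * w"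
    using mp by (simp_all add: is_mp_inverse_def)
  have "q * (x * w) = (x * w * q)\<^sup>\<star>" using q(1) xw by (simp add: star_mult)
  also have "\<dots> = x * w" using q(2) xw by (simp add: mult.assoc)
  finally show "q * x = x" using xwx by (metis mult.assoc)
  have "w * x * p = (p * (w * x))\<^sup>\<star>" using p(1) wx by (simp add: star_mult)
  also have "\<dots> = w * x" using p(2) wx by (simp add: mult.assoc[symmetric])
  finally show "x * p = x" using xwx by (metis mult.assoc)
qed

text \<open>
  The two notions have the same solutions \<open>x\<close>.  Both force \<open>a * b * x = x = x * (b * a)\<close>,
  and under these unit laws each self-adjointness condition is a congruence transform of its
  counterpart.
\<close>

lemma is_hgroup_inverse_iff_is_mp_inverse:
  fixes a b x :: "'a::star_ring"
  assumes mp: "is_mp_inverse a b"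
  shows "is_hgroup_inverse a x \<longleftrightarrow> is_mp_inverse (b * a ^ 3 * b) x"
proof -
  define p q w where "p = b * a" and "q = a * b" and "w = b * a ^ 3 * b"
  have aba: "a * b * a = a" and bab: "b * a * b = b" and q_star: "q\<^sup>\<star> = q" and p_star: "p\<^sup>\<star> = p"
    using mp by (simp_all add: is_mp_inverse_def p_def q_def)
  have qa: "q * a = a" and ap: "a * p = a" and pp: "p * p = p" and qq: "q * q = q"
    and a_star_b_star: "a\<^sup>\<star> * b\<^sup>\<star> = p" and b_star_a_star: "b\<^sup>\<star> * a\<^sup>\<star> = q"
    using aba bab p_star q_star
    by (simp_all add: p_def q_def star_mult[symmetric] mult.assoc[symmetric])
  have w: "w = p * a * q"
    by (simp add: w_def p_def q_def power3_eq_cube mult.assoc)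
  have awa: "a * w * a = a ^ 3"
    using ap qa by (metis w mult.assoc power3_eq_cube)
  have aw: "a ^ 2 * q = a * w" and wa: "p * a ^ 2 = w * a"
    using ap qa by (metis w mult.assoc power2_eq_square)+
  have ranges: "x \<in> range (\<lambda>r. a * r) \<inter> range (\<lambda>r. r * a) \<longleftrightarrow> q * x = x \<and> x * p = x"
    using range_mult_left_iff[OF aba] range_mult_right_iff[OF aba] by (simp add: p_def q_def)
  \<comment> \<open>The dictionary between \<open>a\<close> and \<open>w\<close> for elements satisfying the range condition.\<close>
  have dict: "x * a * x = x * w * x" "a ^ 2 * x = a * (w * x)" "x * a ^ 2 = x * w * a"
    "b * a ^ 2 * x = w * x" "x * a ^ 2 * b = x * w"
    if qx: "q * x = x" and xp: "x * p = x"
  proof -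
    show "x * a * x = x * w * x" using qx xp by (metis w mult.assoc)
    show "a ^ 2 * x = a * (w * x)" using qx aw by (metis mult.assoc)
    show "x * a ^ 2 = x * w * a" using xp wa by (metis mult.assoc)
    show "b * a ^ 2 * x = w * x"
      using qx by (metis w p_def mult.assoc power2_eq_square)
    show "x * a ^ 2 * b = x * w"
      using xp by (metis w q_def mult.assoc power2_eq_square)
  qed
  show ?thesis unfolding w_def[symmetric]
  proof
    assume h: "is_hgroup_inverse a x"
    then have qx: "q * x = x" and xp: "x * p = x"
      using ranges by (simp_all add: is_hgroup_inverse_def)
    note d = dict[OF qx xp]
    have xax: "x * a * x = x" and cube: "a ^ 2 * x * a ^ 2 = a ^ 3"
      and herm_l: "(a ^ 2 * x * a\<^sup>\<star>)\<^sup>\<star> = a ^ 2 * x * a\<^sup>\<star>"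
      and herm_r: "(a\<^sup>\<star> * x * a ^ 2)\<^sup>\<star> = a\<^sup>\<star> * x * a ^ 2"
      using h by (simp_all add: is_hgroup_inverse_def)
    have "w * x * w = (b * a ^ 2 * x) * (a ^ 2 * b)" using d(4,5) by (metis mult.assoc)
    also have "\<dots> = b * (a ^ 2 * x * a ^ 2) * b" by (simp add: mult.assoc)
    finally have wxw: "w * x * w = w" by (simp add: cube w_def)
    have "b * (a ^ 2 * x * a\<^sup>\<star>) * b\<^sup>\<star> = b * a ^ 2 * (x * p)"
      by (simp add: a_star_b_star mult.assoc)
    also have "\<dots> = w * x" by (simp add: xp d(4))
    finally have wx: "(w * x)\<^sup>\<star> = w * x" using star_congruence(1)[OF herm_l, of b] by simp
    have "b\<^sup>\<star> * (a\<^sup>\<star> * x * a ^ 2) * b = q * x * a ^ 2 * b"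
      by (simp add: b_star_a_star mult.assoc[symmetric])
    also have "\<dots> = x * w" by (simp add: qx d(5))
    finally have xw: "(x * w)\<^sup>\<star> = x * w" using star_congruence(2)[OF herm_r, of b] by simp
    show "is_mp_inverse w x" using xax d(1) wxw wx xw by (simp add: is_mp_inverse_def)
  next
    assume m: "is_mp_inverse w x"
    then have xwx: "x * w * x = x" and wxw: "w * x * w = w"
      and wx: "(w * x)\<^sup>\<star> = w * x" and xw: "(x * w)\<^sup>\<star> = x * w"
      by (simp_all add: is_mp_inverse_def)
    have "p * w = w" "w * q = w" using pp qq by (metis w mult.assoc)+
    then have qx: "q * x = x" and xp: "x * p = x"
      using is_mp_inverse_inherits_units[OF m p_star _ q_star] by blast+
    note d = dict[OF qx xp]
    have "a ^ 2 * x * a ^ 2 = a * (w * x * w) * a"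
      using d(2,3) by (metis mult.assoc)
    then have cube: "a ^ 2 * x * a ^ 2 = a ^ 3" by (simp add: wxw awa)
    have herm_l: "(a ^ 2 * x * a\<^sup>\<star>)\<^sup>\<star> = a ^ 2 * x * a\<^sup>\<star>"
      using star_congruence(1)[OF wx, of a] by (simp add: d(2))
    have "a\<^sup>\<star> * x * a ^ 2 = a\<^sup>\<star> * (x * w) * a"
      using d(3) by (simp add: mult.assoc)
    then have herm_r: "(a\<^sup>\<star> * x * a ^ 2)\<^sup>\<star> = a\<^sup>\<star> * x * a ^ 2"
      using star_congruence(2)[OF xw, of a] by simp
    show "is_hgroup_inverse a x"
      unfolding is_hgroup_inverse_def ranges
      using qx xp xwx d(1) cube herm_l herm_r by simp
  qed
qed

theorem theorem2p1:
  fixes a :: "'a::star_ring"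
  shows "(a \<in> R\<^sup>\<H> \<longleftrightarrow> a \<in> R\<^sup>\<dagger> \<and> a\<^sup>\<dagger> * a ^ 3 * a\<^sup>\<dagger> \<in> R\<^sup>\<dagger>) \<and>
    (a \<in> R\<^sup>\<H> \<longrightarrow> a\<^sup>\<H> = (a\<^sup>\<dagger> * a ^ 3 * a\<^sup>\<dagger>)\<^sup>\<dagger>)"
proof (cases "a \<in> R\<^sup>\<dagger>")
  case True
  have same: "is_hgroup_inverse a = is_mp_inverse (a\<^sup>\<dagger> * a ^ 3 * a\<^sup>\<dagger>)"
    by (rule ext, rule is_hgroup_inverse_iff_is_mp_inverse[OF is_mp_inverse_mp_inverse[OF True]])
  have "a \<in> R\<^sup>\<H> \<longleftrightarrow> a\<^sup>\<dagger> * a ^ 3 * a\<^sup>\<dagger> \<in> R\<^sup>\<dagger>"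
    using True by (simp add: hgroup_invertibles_def mp_invertibles_def same)
  moreover have "a\<^sup>\<H> = (a\<^sup>\<dagger> * a ^ 3 * a\<^sup>\<dagger>)\<^sup>\<dagger>"
    unfolding hgroup_inverse_def same mp_inverse_def[of "a\<^sup>\<dagger> * a ^ 3 * a\<^sup>\<dagger>"] ..
  ultimately show ?thesis using True by simp
next
  case False
  then show ?thesis by (simp add: hgroup_invertibles_def)
qed

end
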